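(* Let $G = K_{n_1,n_2,\ldots,n_r}$ be the complete $r$-partite graph with $r \ge 2$ and parts of sizes $n_1 \ge n_2 \ge \cdots \ge n_r \ge 1$, and let $n = n_1 + \cdots + n_r$. Suppose exactly $\alpha$ indices $i$ have $n_i$ odd. Then $$\mathrm{ip}(G) = \begin{cases} \lceil n_1/2 \rceil, & \text{if } 3n_1 > 2n;\\ \lceil (n+\alpha)/4 \rceil, & \text{if } 3\alpha > n;\\ \lceil n/3 \rceil, & \text{if } 3\alpha \le n \text{ and } 3n_1 \le 2n.\end{cases}$$
   Context: An isometric path between two vertices of a graph is a shortest path joining them. The isometric path number $\mathrm{ip}(G)$ of a graph $G$ is the minimum number of isometric paths needed to cover all vertices of $G$. The complete $r$-partite graph $K_{n_1,\ldots,n_r}$ has vertex set partitioned into $r$ nonempty parts of sizes $n_1,\ldots,n_r$, with two vertices adjacent if and only if they lie in different parts. *)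

theory Defs
  imports Complex_Main "HOL-Library.Disjoint_Sets"
    "Graph_Theory.Digraph" "Graph_Theory.Vertex_Walk"
begin

text \<open>
  As in the library, a finite simple graph is a symmetric digraph (locale \<^locale>\<open>graph\<close>) and a
  path is a list of pairwise distinct vertices. A single vertex counts as a path (of length 0).
\<close>

definition isometric_path :: "'a list \<Rightarrow> ('a,'b) pre_digraph \<Rightarrow> bool" where
  "isometric_path p G \<longleftrightarrow> vpath p G \<and>
     (\<forall>q. vpath q G \<and> hd q = hd p \<and> last q = last p \<longrightarrow> vwalk_length p \<le> vwalk_length q)"

definition isometric_path_cover :: "'a list set \<Rightarrow> ('a,'b) pre_digraph \<Rightarrow> bool" where
  "isometric_path_cover P G \<longleftrightarrow> (\<forall>p\<in>P. isometric_path p G) \<and> (\<Union>p\<in>P. set p) = verts G"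

text \<open>
  The paths of a cover may share vertices. The minimum exists for every finite graph, since the
  one-vertex paths form a cover. The two orientations of a path are different lists, but a minimum
  cover never contains both.
\<close>

definition isometric_path_number :: "('a,'b) pre_digraph \<Rightarrow> nat" where
  "isometric_path_number G =
     (LEAST k. \<exists>P. finite P \<and> card P = k \<and> isometric_path_cover P G)"

text \<open>
  The parts are indexed by \<open>1, \<dots>, r\<close>. They are finite because \<^locale>\<open>graph\<close> includes
  finiteness of the vertex set, so \<^const>\<open>card\<close> is their true size.
\<close>

definition complete_multipartite :: "nat \<Rightarrow> (nat \<Rightarrow> nat) \<Rightarrow> ('a,'b) pre_digraph \<Rightarrow> bool" where
  "complete_multipartite r n G \<longleftrightarrow> graph G \<and>
     (\<exists>V. verts G = (\<Union>i\<in>{1..r}. V i) \<and> disjoint_family_on V {1..r} \<and>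
          (\<forall>i\<in>{1..r}. card (V i) = n i) \<and>
          arcs_ends G = {(u, v). \<exists>i\<in>{1..r}. \<exists>j\<in>{1..r}. i \<noteq> j \<and> u \<in> V i \<and> v \<in> V j})"

end

theory Submission
  imports Defs
begin

text \<open>
  In a complete multipartite graph with at least two parts, call \<open>{a, b, c}\<close> with \<open>a, b\<close> (possibly
  equal) in one part and \<open>c\<close> in another a cherry. Cherries are vertex sets of isometric paths, and
  every isometric path lies in a cherry, so covering by cherries is an equivalent problem. A cherry
  has at most three elements and meets at most two parts, each in at most two vertices, so
  \<open>k\<close> of them cover the graph only if \<open>N \<le> 3k\<close> and \<open>\<Sum>i. \<lceil>n i / 2\<rceil> \<le> 2k\<close>, because the \<open>i\<close>-th part
  needs \<open>\<lceil>n i / 2\<rceil>\<close> sets meeting it; also \<open>n i \<le> 2k\<close>. Conversely these three conditions suffice: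
  removing two vertices from a largest part and one vertex from another part, of odd size whenever
  there is one, preserves them with \<open>k\<close> decreased by one. As \<open>\<Sum>i. \<lceil>n i / 2\<rceil> = (N + \<alpha>) / 2\<close>, the
  three cases of the theorem record which of the three conditions is the strongest.
\<close>

definition cherry :: "('i \<Rightarrow> 'a set) \<Rightarrow> 'i set \<Rightarrow> 'a \<times> 'a \<times> 'a \<Rightarrow> bool" where
  "cherry V I t \<longleftrightarrow>
     (\<exists>a b c. t = (a, b, c) \<and> (\<exists>i\<in>I. \<exists>j\<in>I. i \<noteq> j \<and> a \<in> V i \<and> b \<in> V i \<and> c \<in> V j))"

definition cherry_verts :: "'a \<times> 'a \<times> 'a \<Rightarrow> 'a set" where
  "cherry_verts t = (case t of (a, b, c) \<Rightarrow> {a, b, c})"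

lemma card_cherry_verts_le: "card (cherry_verts t) \<le> 3"
  unfolding cherry_verts_def by (auto simp: card_insert_if split: prod.split)

subsection \<open>Isometric paths in complete multipartite graphs\<close>

text \<open>\<open>complete_multipartite\<close> hides the family of parts behind an existential;
  the locale fixes one such family.\<close>

locale multipartite_parts =
  fixes G :: "('a,'b) pre_digraph" and I :: "'i set" and V :: "'i \<Rightarrow> 'a set"
  assumes finite_index: "finite I"
    and two_parts: "\<exists>i\<in>I. \<exists>j\<in>I. i \<noteq> j"
    and finite_part: "i \<in> I \<Longrightarrow> finite (V i)"
    and part_nonempty: "i \<in> I \<Longrightarrow> V i \<noteq> {}"
    and disjoint_parts: "disjoint_family_on V I"
    and verts_eq: "verts G = (\<Union>i\<in>I. V i)"
    and arcs_ends_eq: "arcs_ends G = {(u, v). \<exists>i\<in>I. \<exists>j\<in>I. i \<noteq> j \<and> u \<in> V i \<and> v \<in> V j}"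
begin

lemma same_part: "i \<in> I \<Longrightarrow> j \<in> I \<Longrightarrow> x \<in> V i \<Longrightarrow> x \<in> V j \<Longrightarrow> i = j"
  using disjoint_parts unfolding disjoint_family_on_def by blast

lemma other_vertex: "i \<in> I \<Longrightarrow> \<exists>j\<in>I. \<exists>c\<in>V j. i \<noteq> j"
  using two_parts part_nonempty by (metis all_not_in_conv)

lemma adjacentI: "i \<in> I \<Longrightarrow> j \<in> I \<Longrightarrow> i \<noteq> j \<Longrightarrow> u \<in> V i \<Longrightarrow> v \<in> V j \<Longrightarrow> (u, v) \<in> arcs_ends G"
  unfolding arcs_ends_eq by blast

lemma not_adjacentI: "i \<in> I \<Longrightarrow> u \<in> V i \<Longrightarrow> v \<in> V i \<Longrightarrow> (u, v) \<notin> arcs_ends G"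
  unfolding arcs_ends_eq using same_part by blast

lemma vpath_Cons_Cons:
  "vpath (x # y # p) G \<longleftrightarrow> x \<in> verts G \<and> (x, y) \<in> arcs_ends G \<and> x \<notin> set (y # p) \<and> vpath (y # p) G"
  unfolding vpath_def vwalk_def by auto

lemma vpath_single: "vpath [x] G \<longleftrightarrow> x \<in> verts G"
  unfolding vpath_def vwalk_def by auto

text \<open>Serves as a lower bound on distances: a path between distinct nonadjacent vertices has
  at least three vertices.\<close>

lemma vpath_length2:
  assumes "vpath q G" "hd q \<noteq> last q"
  shows "2 \<le> length q" and "length q = 2 \<Longrightarrow> (hd q, last q) \<in> arcs_ends G"
proof -
  \<comment> \<open>\<open>vwalk_arcs.cases\<close> is used for its split into \<open>[]\<close>,
    \<open>[x]\<close> and \<open>x # y # q'\<close>.\<close>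
  obtain x y q' where q: "q = x # y # q'"
    using assms by (cases q rule: vwalk_arcs.cases) (auto simp: vpath_def vwalk_def)
  show "2 \<le> length q" using q by simp
  show "(hd q, last q) \<in> arcs_ends G" if "length q = 2"
    using that assms(1) q by (auto simp: vpath_Cons_Cons)
qed

lemma cherry_covered_by_isometric_path:
  assumes "cherry V I t"
  shows "\<exists>p. isometric_path p G \<and> cherry_verts t = set p"
proof -
  obtain a b c i j where t: "t = (a, b, c)" and ij: "i \<in> I" "j \<in> I" "i \<noteq> j"
    and abc: "a \<in> V i" "b \<in> V i" "c \<in> V j"
    using assms unfolding cherry_def by blast
  have v: "a \<in> verts G" "b \<in> verts G" "c \<in> verts G" using ij abc verts_eq by auto
  have ac: "(a, c) \<in> arcs_ends G" "(c, b) \<in> arcs_ends G" using adjacentI ij abc by auto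
  have ne: "a \<noteq> c" "b \<noteq> c" using same_part ij abc by blast+
  show ?thesis
  proof (cases "a = b")
    case True
    have "2 \<le> length q" if "vpath q G" "hd q = a" "last q = c" for q
      using vpath_length2(1)[of q] that ne by simp
    then have "vwalk_length [a, c] \<le> vwalk_length q" if "vpath q G" "hd q = a" "last q = c" for q
      using that by fastforce
    then have "isometric_path [a, c] G"
      unfolding isometric_path_def using v ac ne by (simp add: vpath_Cons_Cons vpath_single)
    then show ?thesis using t True by (intro exI[of _ "[a, c]"]) (auto simp: cherry_verts_def)
  next
    case False
    have "(a, b) \<notin> arcs_ends G" using not_adjacentI ij abc by blast
    then have "3 \<le> length q" if "vpath q G" "hd q = a" "last q = b" for q
      using vpath_length2[of q] that False by (metis Suc_leI eval_nat_numeral(3) le_neq_implies_less)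
    then have "vwalk_length [a, c, b] \<le> vwalk_length q" if "vpath q G" "hd q = a" "last q = b" for q
      using that by fastforce
    then have "isometric_path [a, c, b] G"
      unfolding isometric_path_def using v ac ne False
      by (simp add: vpath_Cons_Cons vpath_single)
    then show ?thesis using t by (intro exI[of _ "[a, c, b]"]) (auto simp: cherry_verts_def)
  qed
qed

text \<open>Any two vertices are joined by an explicit path on at most three vertices, through
  another part if they share one, and an isometric path cannot be longer. The second bound later
  forces the ends of a three-vertex path into one part.\<close>

lemma isometric_path_length_le:
  assumes "isometric_path p G"
  shows "length p \<le> 3" and "(hd p, last p) \<in> arcs_ends G \<Longrightarrow> length p \<le> 2"
proof -
  let ?x = "hd p" and ?y = "last p"
  have p: "p \<noteq> []" "distinct p" and sub: "set p \<subseteq> verts G"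
    using assms by (auto simp: isometric_path_def vpath_def vwalk_def)
  have xy: "?x \<in> verts G" "?y \<in> verts G" using p sub by auto
  \<comment> \<open>\<open>vwalk_length\<close> counts arcs; since both lists are nonempty, it
    compares like the number of vertices.\<close>
  have le: "length p \<le> length q" if "vpath q G" "hd q = ?x" "last q = ?y" for q
  proof -
    have "q \<noteq> []" using that by (auto simp: vpath_def vwalk_def)
    moreover have "vwalk_length p \<le> vwalk_length q"
      using assms that unfolding isometric_path_def by blast
    ultimately show ?thesis by (cases q) auto
  qed
  show adj: "length p \<le> 2" if e: "(?x, ?y) \<in> arcs_ends G"
  proof -
    have "?x \<noteq> ?y" using e not_adjacentI xy verts_eq by auto
    then have "vpath [?x, ?y] G" using e xy by (simp add: vpath_Cons_Cons vpath_single)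
    from le[OF this] show ?thesis by simp
  qed
  show "length p \<le> 3"
  proof (cases "(?x, ?y) \<in> arcs_ends G \<or> ?x = ?y")
    case True
    then show ?thesis
    proof
      assume "?x = ?y"
      then have "vpath [?x] G" using xy by (simp add: vpath_single)
      from le[OF this] \<open>?x = ?y\<close> show ?thesis by simp
    qed (use adj in force)
  next
    case False
    obtain i where i: "i \<in> I" "?x \<in> V i" using xy verts_eq by auto
    have yi: "?y \<in> V i" using False i xy verts_eq adjacentI by (metis UN_E)
    obtain j c where j: "j \<in> I" "c \<in> V j" "i \<noteq> j" using other_vertex i by blast
    have "c \<in> verts G" "c \<noteq> ?x" "c \<noteq> ?y" using j verts_eq same_part i yi by auto
    moreover have "(?x, c) \<in> arcs_ends G" "(c, ?y) \<in> arcs_ends G"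
      using adjacentI i j yi by auto
    ultimately have "vpath [?x, c, ?y] G" using xy False
      by (simp add: vpath_Cons_Cons vpath_single)
    from le[OF this] show ?thesis by simp
  qed
qed

text \<open>Only inclusion can hold: a one-vertex path has to be padded with a vertex of another
  part.\<close>

lemma isometric_path_imp_cherry:
  assumes "isometric_path p G"
  shows "\<exists>t. cherry V I t \<and> set p \<subseteq> cherry_verts t"
proof -
  have vp: "vpath p G" using assms isometric_path_def by blast
  then have "p \<noteq> []" by (auto simp: vpath_def vwalk_def)
  then consider x where "p = [x]" | x y where "p = [x, y]" | x y z where "p = [x, y, z]"
    using isometric_path_length_le(1)[OF assms]
    by (cases p rule: remdups_adj.cases; cases "tl (tl p)") auto
  then show ?thesis
  proof cases
    case (1 x)
    obtain i where "i \<in> I" "x \<in> V i" using vp 1 vpath_single verts_eq by auto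
    moreover obtain j c where "j \<in> I" "c \<in> V j" "i \<noteq> j" using other_vertex \<open>i \<in> I\<close> by blast
    ultimately have "cherry V I (x, x, c)" unfolding cherry_def by blast
    then show ?thesis using 1 by (intro exI[of _ "(x, x, c)"]) (simp add: cherry_verts_def)
  next
    case (2 x y)
    have "(x, y) \<in> arcs_ends G" using vp 2 by (simp add: vpath_Cons_Cons)
    then have "cherry V I (x, x, y)" unfolding cherry_def arcs_ends_eq by blast
    then show ?thesis using 2 by (intro exI[of _ "(x, x, y)"]) (simp add: cherry_verts_def)
  next
    case (3 x y z)
    have e: "(x, y) \<in> arcs_ends G" and z: "z \<in> verts G"
      using vp 3 by (simp_all add: vpath_Cons_Cons vpath_single)
    obtain i j where ij: "i \<in> I" "j \<in> I" "i \<noteq> j" "x \<in> V i" "y \<in> V j"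
      using e unfolding arcs_ends_eq by blast
    \<comment> \<open>Adjacent ends would make the path have at most two vertices, so x and z share
      a part and y is the centre of the cherry.\<close>
    have "(x, z) \<notin> arcs_ends G" using isometric_path_length_le(2)[OF assms] 3 by auto
    then have "z \<in> V i" using z ij verts_eq adjacentI by (metis UN_E)
    then have "cherry V I (x, z, y)" using ij unfolding cherry_def by blast
    then show ?thesis using 3 by (intro exI[of _ "(x, z, y)"]) (auto simp: cherry_verts_def)
  qed
qed

subsection \<open>The lower bounds\<close>

lemma cherry_meets_le_2:
  assumes "cherry V I t"
  shows "card {i\<in>I. cherry_verts t \<inter> V i \<noteq> {}} \<le> 2"
proof -
  obtain a b c i j where t: "t = (a, b, c)" and ij: "i \<in> I" "j \<in> I"
    and abc: "a \<in> V i" "b \<in> V i" "c \<in> V j"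
    using assms unfolding cherry_def by blast
  have "{i\<in>I. cherry_verts t \<inter> V i \<noteq> {}} \<subseteq> {i, j}"
    using ij abc same_part t unfolding cherry_verts_def by auto
  then have "card {i\<in>I. cherry_verts t \<inter> V i \<noteq> {}} \<le> card {i, j}"
    by (intro card_mono) auto
  also have "\<dots> \<le> 2" by (simp add: card_insert_if)
  finally show ?thesis .
qed

lemma cherry_Int_part_le_2:
  assumes "cherry V I t" "i \<in> I"
  shows "card (cherry_verts t \<inter> V i) \<le> 2"
proof -
  obtain a b c k j where t: "t = (a, b, c)" and kj: "k \<in> I" "j \<in> I" "k \<noteq> j"
    and abc: "a \<in> V k" "b \<in> V k" "c \<in> V j"
    using assms unfolding cherry_def by blast
  have "cherry_verts t \<inter> V i \<subseteq> {a, b} \<or> cherry_verts t \<inter> V i \<subseteq> {c}"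
    using kj abc same_part[OF assms(2)] t unfolding cherry_verts_def by blast
  then show ?thesis
  proof
    assume "cherry_verts t \<inter> V i \<subseteq> {a, b}"
    then have "card (cherry_verts t \<inter> V i) \<le> card {a, b}" by (intro card_mono) auto
    also have "\<dots> \<le> 2" by (simp add: card_insert_if)
    finally show ?thesis .
  next
    assume "cherry_verts t \<inter> V i \<subseteq> {c}"
    then have "card (cherry_verts t \<inter> V i) \<le> card {c}" by (intro card_mono) auto
    then show ?thesis by simp
  qed
qed

text \<open>After enlarging every path to a cherry, the first bound counts vertices, the second
  counts incidences between paths and parts, and the third counts vertices inside one part.\<close>

lemma isometric_path_cover_bounds:
  assumes "isometric_path_cover P G" "finite P"
  shows "(\<Sum>i\<in>I. card (V i)) \<le> 3 * card P"
    and "(\<Sum>i\<in>I. (card (V i) + 1) div 2) \<le> 2 * card P"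
    and "i \<in> I \<Longrightarrow> card (V i) \<le> 2 * card P"
proof -
  have "\<forall>p\<in>P. \<exists>t. cherry V I t \<and> set p \<subseteq> cherry_verts t"
    using assms isometric_path_imp_cherry unfolding isometric_path_cover_def by blast
  \<comment> \<open>All sums below run over P and not over the image of f, so two paths may share a
    cherry.\<close>
  then obtain f where "\<forall>p\<in>P. cherry V I (f p) \<and> set p \<subseteq> cherry_verts (f p)"
    by (rule bchoice[elim_format]) (erule exE)
  then have f: "\<And>p. p \<in> P \<Longrightarrow> cherry V I (f p)"
    "\<And>p. p \<in> P \<Longrightarrow> set p \<subseteq> cherry_verts (f p)"
    by simp_all
  have cov: "(\<Union>i\<in>I. V i) \<subseteq> (\<Union>p\<in>P. cherry_verts (f p))"
  proof
    fix x assume "x \<in> (\<Union>i\<in>I. V i)"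
    then obtain p where "p \<in> P" "x \<in> set p"
      using assms(1) unfolding isometric_path_cover_def verts_eq by blast
    then show "x \<in> (\<Union>p\<in>P. cherry_verts (f p))" using f(2) by blast
  qed
  have fin: "finite (cherry_verts t)" for t :: "'a \<times> 'a \<times> 'a"
    unfolding cherry_verts_def by (auto split: prod.split)
  have "(\<Sum>i\<in>I. card (V i)) = card (\<Union>i\<in>I. V i)"
    using finite_index finite_part disjoint_parts
    by (subst card_UN_disjoint') auto
  also have "\<dots> \<le> card (\<Union>p\<in>P. cherry_verts (f p))"
    using cov fin assms(2) by (intro card_mono) auto
  also have "\<dots> \<le> (\<Sum>p\<in>P. card (cherry_verts (f p)))"
    using assms(2) by (rule card_UN_le)
  also have "\<dots> \<le> (\<Sum>p\<in>P. 3)" by (intro sum_mono card_cherry_verts_le)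
  finally show "(\<Sum>i\<in>I. card (V i)) \<le> 3 * card P" by simp
  define M where "M i = {p\<in>P. cherry_verts (f p) \<inter> V i \<noteq> {}}" for i
  have M: "card (V i) \<le> 2 * card (M i)" if "i \<in> I" for i
  proof -
    have "V i \<subseteq> (\<Union>p\<in>M i. cherry_verts (f p) \<inter> V i)"
      using cov that unfolding M_def by blast
    then have "card (V i) \<le> card (\<Union>p\<in>M i. cherry_verts (f p) \<inter> V i)"
      using fin assms(2) by (intro card_mono) (auto simp: M_def)
    also have "\<dots> \<le> (\<Sum>p\<in>M i. card (cherry_verts (f p) \<inter> V i))"
      using assms(2) by (intro card_UN_le) (simp add: M_def)
    also have "\<dots> \<le> (\<Sum>p\<in>M i. 2)"
      using that f(1) by (intro sum_mono cherry_Int_part_le_2) (auto simp: M_def)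
    finally show ?thesis by simp
  qed
  show "card (V i) \<le> 2 * card P" if "i \<in> I"
  proof -
    have "card (M i) \<le> card P" using assms(2) by (intro card_mono) (auto simp: M_def)
    then show ?thesis using M[OF that] by linarith
  qed
  have "(\<Sum>i\<in>I. (card (V i) + 1) div 2) \<le> (\<Sum>i\<in>I. card (M i))"
    using M by (intro sum_mono) fastforce
  \<comment> \<open>Double counting of the pairs of a part and a path whose cherry meets it.\<close>
  also have "\<dots> = (\<Sum>p\<in>P. card {i\<in>I. cherry_verts (f p) \<inter> V i \<noteq> {}})"
    unfolding M_def using finite_index assms(2) by (intro sum_multicount_gen) auto
  also have "\<dots> \<le> (\<Sum>p\<in>P. 2)" using f(1) by (intro sum_mono cherry_meets_le_2)
  finally show "(\<Sum>i\<in>I. (card (V i) + 1) div 2) \<le> 2 * card P" by simp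
qed

end

subsection \<open>Covering by cherries\<close>

lemma sum_remove2:
  fixes f :: "'i \<Rightarrow> nat"
  assumes "finite I" "i \<in> I" "j \<in> I" "i \<noteq> j"
  shows "sum f I = f i + f j + sum f (I - {i, j})"
proof -
  have "sum f I = f i + sum f (I - {i})" using assms by (simp add: sum.remove)
  also have "sum f (I - {i}) = f j + sum f (I - {i} - {j})" using assms by (simp add: sum.remove)
  finally show ?thesis by (simp add: Diff_insert2 [symmetric] insert_commute)
qed

text \<open>Subtraction is truncated: a part that is too small just becomes empty. The delicate
  cases are those where the total drops by less than three or the sum of halves by less than two;
  there another hypothesis has slack.\<close>

lemma reduce_sizes:
  fixes m :: "'i \<Rightarrow> nat"
  assumes "finite I" "\<exists>i\<in>I. \<exists>j\<in>I. i \<noteq> j"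
    and max: "\<And>i. i \<in> I \<Longrightarrow> m i \<le> 2 * Suc k"
    and total: "(\<Sum>i\<in>I. m i) \<le> 3 * Suc k"
    and halves: "(\<Sum>i\<in>I. (m i + 1) div 2) \<le> 2 * Suc k"
  obtains i j m' where "i \<in> I" "j \<in> I" "i \<noteq> j" "m' = m(i := m i - 2, j := m j - 1)"
    "\<And>i. i \<in> I \<Longrightarrow> m' i \<le> 2 * k" "(\<Sum>i\<in>I. m' i) \<le> 3 * k"
    "(\<Sum>i\<in>I. (m' i + 1) div 2) \<le> 2 * k"
proof -
  have ne: "I \<noteq> {}" using assms(2) by blast
  obtain i where i: "i \<in> I" "\<And>l. l \<in> I \<Longrightarrow> m l \<le> m i"
  proof -
    have "Max (m ` I) \<in> m ` I" using assms(1) ne by simp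
    then obtain i where "i \<in> I" "m i = Max (m ` I)" by auto
    then show thesis using that assms(1) by simp
  qed
  \<comment> \<open>Preference order for j: odd size, then positive size, then anything. Thus an
    even \<open>m j\<close> makes all parts besides i even, and \<open>m j = 0\<close> makes them
    all empty.\<close>
  obtain j where j: "j \<in> I" "i \<noteq> j"
    and j_odd: "\<And>l. l \<in> I - {i, j} \<Longrightarrow> odd (m l) \<Longrightarrow> odd (m j)"
    and j_pos: "\<And>l. l \<in> I - {i, j} \<Longrightarrow> m l > 0 \<Longrightarrow> m j > 0"
  proof -
    consider j where "j \<in> I - {i}" "odd (m j)"
      | j where "j \<in> I - {i}" "m j > 0" "\<And>l. l \<in> I - {i} \<Longrightarrow> even (m l)"
      | j where "j \<in> I - {i}" "\<And>l. l \<in> I - {i} \<Longrightarrow> m l = 0"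
      using assms(2) by (metis DiffI empty_iff insert_iff neq0_conv)
    then show thesis
    proof cases
      case (1 j) then show thesis by (intro that[of j]) (auto intro: odd_pos)
    next
      case (2 j) then show thesis by (intro that[of j]) auto
    next
      case (3 j) then show thesis by (intro that[of j]) auto
    qed
  qed
  define h where "h x = (x + 1) div 2" for x :: nat
  \<comment> \<open>R and H are the contributions of the untouched parts to the total and to the sum
    of halves.\<close>
  define R where "R = sum m (I - {i, j})"
  define H where "H = (\<Sum>l\<in>I - {i, j}. h (m l))"
  let ?m = "m(i := m i - 2, j := m j - 1)"
  have mij: "?m i = m i - 2" "?m j = m j - 1" using j by simp_all
  have N: "sum m I = m i + m j + R"
    unfolding R_def using assms(1) i j by (intro sum_remove2) auto
  have S: "(\<Sum>l\<in>I. h (m l)) = h (m i) + h (m j) + H"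
    unfolding H_def using assms(1) i j by (intro sum_remove2) auto
  have "sum ?m I = ?m i + ?m j + sum ?m (I - {i, j})"
    using assms(1) i j by (intro sum_remove2) auto
  also have "sum ?m (I - {i, j}) = R" unfolding R_def by (intro sum.cong) auto
  finally have N': "sum ?m I = (m i - 2) + (m j - 1) + R" unfolding mij .
  have "(\<Sum>l\<in>I. h (?m l)) = h (?m i) + h (?m j) + (\<Sum>l\<in>I - {i, j}. h (?m l))"
    using assms(1) i j by (intro sum_remove2) auto
  also have "(\<Sum>l\<in>I - {i, j}. h (?m l)) = H" unfolding H_def by (intro sum.cong) auto
  finally have S': "(\<Sum>l\<in>I. h (?m l)) = h (m i - 2) + h (m j - 1) + H" unfolding mij .
  have T: "m i + m j + R \<le> 3 * k + 3" using total N by simp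
  have T2: "h (m i) + h (m j) + H \<le> 2 * k + 2" using halves S unfolding h_def by simp
  have ji: "m j \<le> m i" using i j by blast
  have mi: "m i \<le> 2 * k + 2" using max[OF i(1)] by simp
  have R0: "R = 0" if "m j = 0"
    unfolding R_def using j_pos that by (intro sum.neutral) fastforce
  have R1: "R = H" if "m i \<le> 1"
  proof -
    have "m l = h (m l)" if "l \<in> I" for l
      using i(2)[OF that] \<open>m i \<le> 1\<close> unfolding h_def by (cases "m l = 0") auto
    then show ?thesis unfolding R_def H_def by (intro sum.cong) auto
  qed
  have R2: "R = 2 * H" if "even (m j)"
  proof -
    have "m l = 2 * h (m l)" if "l \<in> I - {i, j}" for l
      using j_odd[OF that] \<open>even (m j)\<close> unfolding h_def by presburger
    then show ?thesis unfolding R_def H_def sum_distrib_left by (intro sum.cong) auto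
  qed
  have rest: "m l \<le> R \<and> h (m l) \<le> H" if "l \<in> I - {i, j}" for l
    unfolding R_def H_def using assms(1) that
    by (auto intro!: member_le_sum[where f = m] member_le_sum[where f = "\<lambda>l. h (m l)"])
  show thesis
  proof (rule that[OF i(1) j refl])
    show "?m l \<le> 2 * k" if l: "l \<in> I" for l
    proof -
      consider "l = i" | "l = j" | "l \<in> I - {i, j}" using l by blast
      then show ?thesis
      proof cases
        case 1 then show ?thesis using mi j by simp
      next
        case 2
        \<comment> \<open>From \<open>2 * m j\<close> \<le> \<open>m i + m j\<close> \<le>
          \<open>3 * k + 3\<close> it follows that \<open>m j\<close> \<le>
          \<open>2 * k + 1\<close>.\<close>
        then show ?thesis using ji T mi by auto
      next
        case 3
        \<comment> \<open>Otherwise i and l have at least \<open>2 * k + 1\<close> vertices each and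
          j at least one, so the total forces \<open>k = 0\<close>; but then three nonempty parts
          violate the bound on halves.\<close>
        have "m l \<le> 2 * k"
        proof (rule ccontr)
          assume c: "\<not> m l \<le> 2 * k"
          have "m l \<le> m i" "m j > 0" using i(2) l j_pos 3 c by auto
          moreover have "m l \<le> R" "h (m l) \<le> H" using rest 3 by auto
          ultimately have "k = 0" using c T by linarith
          moreover have "h (m l) > 0" "h (m i) > 0" "h (m j) > 0"
            using c \<open>m l \<le> m i\<close> \<open>m j > 0\<close> unfolding h_def by auto
          ultimately show False using T2 \<open>h (m l) \<le> H\<close> by simp
        qed
        then show ?thesis using 3 by auto
      qed
    qed
    have "(m i - 2) + (m j - 1) + R \<le> 3 * k"
    proof (cases "m j = 0 \<or> m i \<ge> 2")
      case True
      then show ?thesis using T R0 mi by (cases "m j = 0") auto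
    next
      case False
      \<comment> \<open>Here the total drops by only two. All sizes are at most one, so the total
        equals the sum of halves, which is at most \<open>2 * k + 2\<close>.\<close>
      then have "m i = 1" "m j = 1" using ji by auto
      then show ?thesis using T2 R1 by (simp add: h_def)
    qed
    then show "sum ?m I \<le> 3 * k" using N' by simp
    have "h (m i - 2) + h (m j - 1) + H \<le> 2 * k"
    proof (cases "odd (m j)")
      case True
      \<comment> \<open>The drop for i also occurs when \<open>m i = 1\<close>, since
        \<open>h 1 = 1\<close> and \<open>h 0 = 0\<close>.\<close>
      then have "h (m j) = h (m j - 1) + 1" "h (m i) = h (m i - 2) + 1"
        using ji unfolding h_def by (presburger, cases "m i \<ge> 2") (auto elim!: oddE)
      then show ?thesis using T2 by linarith
    next
      case even: False
      then have R: "R = 2 * H" and hj: "2 * h (m j) = m j" "h (m j - 1) = h (m j)"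
        using R2 unfolding h_def by (auto elim!: evenE)
      show ?thesis
      proof (cases "m j = 0")
        case True
        then show ?thesis using R R0 mi unfolding h_def by auto
      next
        case False
        then have "m j \<ge> 2" "m i \<ge> 2" using even ji by (auto elim!: evenE)
        then have hi: "h (m i - 2) = h (m i) - 1" "2 * h (m i) \<le> m i + 1" "h (m i) > 0" "k > 0"
          using T unfolding h_def by auto
        \<comment> \<open>The sum of halves drops by only one, but at most \<open>m i\<close> is
          odd, so twice this sum is at most the total plus one. For \<open>k > 0\<close> this leaves
          the needed slack of one.\<close>
        have "2 * (h (m i) + h (m j) + H) \<le> 3 * k + 4"
          using T R hj(1) hi(2) by simp
        then have "h (m i) + h (m j) + H \<le> 2 * k + 1" using hi(4) by presburger
        then show ?thesis unfolding hi(1) hj(2) using hi(3) by linarith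
      qed
    qed
    then show "(\<Sum>l\<in>I. (?m l + 1) div 2) \<le> 2 * k" using S' unfolding h_def by simp
  qed
qed

text \<open>A may have fewer than two elements, so a and b are taken from U and may coincide;
  truncated subtraction matches the sizes in \<open>reduce_sizes\<close>.\<close>

lemma remove_two_elements:
  assumes "finite A" "U \<noteq> {}" "A \<subseteq> U"
  obtains a b where "a \<in> U" "b \<in> U" "card (A - {a, b}) = card A - 2"
    "card (A - {a}) = card A - 1"
proof (cases "A = {}")
  case True
  then show thesis using that assms by auto
next
  case False
  then obtain a where a: "a \<in> A" by blast
  show thesis
  proof (cases "A = {a}")
    case True
    then show thesis using that[of a a] assms by auto
  next
    case False
    then obtain b where b: "b \<in> A" "b \<noteq> a" using a by blast
    have "card (A - {a, b}) = card A - card {a, b}"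
      using a b assms by (intro card_Diff_subset) auto
    moreover have "card (A - {a}) = card A - 1" using a assms by simp
    ultimately show thesis using that[of a b] a b assms by (simp add: subset_iff card_insert_if)
  qed
qed

text \<open>Induction on k, where V holds the vertices still to be covered and shrinks, while U is
  fixed and nonempty. Cherries live in U, so one can always be formed, even when parts of V have run
  out.\<close>

lemma cover_by_cherries:
  fixes U V :: "'i \<Rightarrow> 'a set"
  assumes "finite I" "\<exists>i\<in>I. \<exists>j\<in>I. i \<noteq> j" "\<And>i. i \<in> I \<Longrightarrow> U i \<noteq> {}"
    and "\<And>i. i \<in> I \<Longrightarrow> V i \<subseteq> U i" "\<And>i. i \<in> I \<Longrightarrow> finite (V i)"
    and "\<And>i. i \<in> I \<Longrightarrow> card (V i) \<le> 2 * k"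
    and "(\<Sum>i\<in>I. card (V i)) \<le> 3 * k" "(\<Sum>i\<in>I. (card (V i) + 1) div 2) \<le> 2 * k"
  shows "\<exists>T. finite T \<and> card T \<le> k \<and> (\<forall>t\<in>T. cherry U I t) \<and>
    (\<Union>i\<in>I. V i) \<subseteq> (\<Union>t\<in>T. cherry_verts t)"
  using assms(4-)
proof (induction k arbitrary: V)
  case 0
  then have "(\<Union>i\<in>I. V i) = {}" by simp
  then show ?case by (intro exI[of _ "{}"]) simp
next
  case (Suc k)
  obtain i j m where ij: "i \<in> I" "j \<in> I" "i \<noteq> j"
    and m: "m = (\<lambda>i. card (V i))(i := card (V i) - 2, j := card (V j) - 1)"
      "\<And>i. i \<in> I \<Longrightarrow> m i \<le> 2 * k" "(\<Sum>i\<in>I. m i) \<le> 3 * k" "(\<Sum>i\<in>I. (m i + 1) div 2) \<le> 2 * k"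
    using reduce_sizes[OF assms(1,2) Suc.prems(3-5)] by blast
  obtain a b where ab: "a \<in> U i" "b \<in> U i" "card (V i - {a, b}) = card (V i) - 2"
    using remove_two_elements[OF Suc.prems(2) assms(3) Suc.prems(1)] ij by metis
  obtain c where c: "c \<in> U j" "card (V j - {c}) = card (V j) - 1"
    using remove_two_elements[OF Suc.prems(2) assms(3) Suc.prems(1)] ij by metis
  define W where "W = V(i := V i - {a, b}, j := V j - {c})"
  have W: "card (W l) = m l" "W l \<subseteq> V l" for l
    unfolding W_def m(1) using ij ab c by auto
  have "\<exists>T. finite T \<and> card T \<le> k \<and> (\<forall>t\<in>T. cherry U I t) \<and>
      (\<Union>i\<in>I. W i) \<subseteq> (\<Union>t\<in>T. cherry_verts t)"
  proof (rule Suc.IH)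
    show "W l \<subseteq> U l" "finite (W l)" if "l \<in> I" for l
      using W(2)[of l] Suc.prems(1,2)[OF that] finite_subset by auto
  qed (use W(1) m in simp_all)
  then obtain T where T: "finite T" "card T \<le> k" "\<forall>t\<in>T. cherry U I t"
    "(\<Union>i\<in>I. W i) \<subseteq> (\<Union>t\<in>T. cherry_verts t)" by blast
  have "cherry U I (a, b, c)" unfolding cherry_def using ij ab c by blast
  moreover have "card (insert (a, b, c) T) \<le> Suc k"
    using T by (simp add: card_insert_if)
  moreover have "V l \<subseteq> W l \<union> {a, b, c}" for l unfolding W_def by auto
  then have "(\<Union>i\<in>I. V i) \<subseteq> (\<Union>t\<in>insert (a, b, c) T. cherry_verts t)"
    using T(4) unfolding cherry_verts_def by fastforce
  ultimately show ?case using T(1,3) by (intro exI[of _ "insert (a, b, c) T"]) auto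
qed

section \<open>The isometric path number as the least solution of three inequalities\<close>

context multipartite_parts
begin

theorem isometric_path_number_le_iff:
  "isometric_path_number G \<le> k \<longleftrightarrow> (\<forall>i\<in>I. card (V i) \<le> 2 * k) \<and>
     (\<Sum>i\<in>I. card (V i)) \<le> 3 * k \<and> (\<Sum>i\<in>I. (card (V i) + 1) div 2) \<le> 2 * k"
  (is "_ \<longleftrightarrow> ?B k")
proof -
  define Q where "Q k \<longleftrightarrow> (\<exists>P. finite P \<and> card P = k \<and> isometric_path_cover P G)" for k
  have number: "isometric_path_number G = (LEAST k. Q k)"
    unfolding isometric_path_number_def Q_def ..
  \<comment> \<open>Only some k' \<le> k is obtained, because fewer than k cherries may suffice and
    distinct cherries may yield the same path.\<close>
  have upper: "\<exists>k'\<le>k. Q k'" if B: "?B k" for k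
  proof -
    obtain T where T: "finite T" "card T \<le> k" "\<forall>t\<in>T. cherry V I t"
      "(\<Union>i\<in>I. V i) \<subseteq> (\<Union>t\<in>T. cherry_verts t)"
      using cover_by_cherries[OF finite_index two_parts, of V V k]
        part_nonempty finite_part B by blast
    obtain f where f: "\<And>t. t \<in> T \<Longrightarrow> isometric_path (f t) G \<and> cherry_verts t = set (f t)"
      using T(3) cherry_covered_by_isometric_path by metis
    have "set p \<subseteq> verts G" if "isometric_path p G" for p
      using that unfolding isometric_path_def vpath_def vwalk_def by blast
    then have "(\<Union>p\<in>f ` T. set p) \<subseteq> verts G" using f by (simp add: UN_subset_iff)
    moreover have "verts G \<subseteq> (\<Union>p\<in>f ` T. set p)" using f T(4) verts_eq by simp
    ultimately have "isometric_path_cover (f ` T) G"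
      unfolding isometric_path_cover_def using f by simp
    moreover have "card (f ` T) \<le> k" using T card_image_le order_trans by blast
    ultimately show ?thesis using T(1) unfolding Q_def by blast
  qed
  have lower: "?B k" if "Q k" for k
    using that isometric_path_cover_bounds unfolding Q_def by blast
  have mono: "?B k'" if "?B k" "k \<le> k'" for k k'
    using that by (meson le_trans mult_le_mono2)
  \<comment> \<open>The number of vertices satisfies the bounds, so some cover exists and the
    \<open>LEAST\<close> is attained.\<close>
  have "?B (\<Sum>i\<in>I. card (V i))"
  proof -
    have "card (V i) \<le> (\<Sum>i\<in>I. card (V i))" if "i \<in> I" for i
      using that finite_index by (intro member_le_sum) auto
    moreover have "(\<Sum>i\<in>I. (card (V i) + 1) div 2) \<le> (\<Sum>i\<in>I. card (V i))"
      by (intro sum_mono) linarith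
    ultimately show ?thesis by fastforce
  qed
  from upper[OF this] obtain k' where "Q k'" by blast
  then have "Q (isometric_path_number G)"
    unfolding number by (rule LeastI)
  note attained = lower[OF this]
  show ?thesis
  proof
    assume "isometric_path_number G \<le> k"
    with attained show "?B k" by (rule mono)
  next
    assume "?B k"
    from upper[OF this] obtain k' where "k' \<le> k" "Q k'" by blast
    from this(2) have "isometric_path_number G \<le> k'"
      unfolding number by (rule Least_le)
    then show "isometric_path_number G \<le> k" using \<open>k' \<le> k\<close> by (rule order_trans)
  qed
qed

end

section \<open>Arithmetic of the three cases\<close>

lemma sum_halves:
  fixes m :: "'i \<Rightarrow> nat"
  assumes "finite I"
  shows "2 * (\<Sum>i\<in>I. (m i + 1) div 2) = sum m I + card {i\<in>I. odd (m i)}"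
proof -
  have "2 * (\<Sum>i\<in>I. (m i + 1) div 2) = (\<Sum>i\<in>I. m i + (if odd (m i) then 1 else 0))"
    unfolding sum_distrib_left by (intro sum.cong) auto
  also have "\<dots> = sum m I + card {i\<in>I. odd (m i)}"
    using assms by (simp add: sum.distrib sum.If_cases Int_def)
  finally show ?thesis .
qed

text \<open>The ceiling of x/d is the least natural k with x \<le> d * k, and the hypotheses say
  that q is this least k.\<close>

lemma int_eq_ceiling_divide:
  assumes "d > 0" "x \<le> d * q" "\<And>k. x \<le> d * k \<Longrightarrow> q \<le> k"
  shows "int q = \<lceil>real x / real d\<rceil>"
proof (rule antisym)
  define k where "k = nat \<lceil>real x / real d\<rceil>"
  have "real x / real d \<le> real k" unfolding k_def by (rule real_nat_ceiling_ge)
  then have "real x \<le> real (d * k)" using assms(1) by (simp add: field_simps)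
  then have "q \<le> k" using assms(3) by (simp only: of_nat_le_iff)
  moreover have "int k = \<lceil>real x / real d\<rceil>"
    unfolding k_def by (subst int_nat_eq) (simp add: order.strict_trans2[of "-1" 0])
  ultimately show "int q \<le> \<lceil>real x / real d\<rceil>" by linarith
  have "real x \<le> real (d * q)" using assms(2) by (simp only: of_nat_le_iff)
  then have "real x / real d \<le> real q" using assms(1) by (simp add: field_simps)
  then show "\<lceil>real x / real d\<rceil> \<le> int q" by (simp add: ceiling_le_iff)
qed

theorem theorem4:
  fixes G :: "('a,'b) pre_digraph" and r :: nat and n :: "nat \<Rightarrow> nat" and N \<alpha> :: nat
  assumes "r \<ge> 2"
    and "\<And>i. i \<in> {1..r} \<Longrightarrow> n i \<ge> 1"
    and "\<And>i j. 1 \<le> i \<Longrightarrow> i \<le> j \<Longrightarrow> j \<le> r \<Longrightarrow> n j \<le> n i"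
    and "complete_multipartite r n G"
    and "N = (\<Sum>i=1..r. n i)"
    and "\<alpha> = card {i\<in>{1..r}. odd (n i)}"
  shows "(3 * n 1 > 2 * N \<longrightarrow> int (isometric_path_number G) = \<lceil>real (n 1) / 2\<rceil>) \<and>
         (3 * \<alpha> > N \<longrightarrow> int (isometric_path_number G) = \<lceil>real (N + \<alpha>) / 4\<rceil>) \<and>
         (3 * \<alpha> \<le> N \<and> 3 * n 1 \<le> 2 * N \<longrightarrow>
            int (isometric_path_number G) = \<lceil>real N / 3\<rceil>)"
proof -
  let ?I = "{1..r}" and ?q = "isometric_path_number G"
  obtain V where V: "verts G = (\<Union>i\<in>?I. V i)" "disjoint_family_on V ?I"
    "\<And>i. i \<in> ?I \<Longrightarrow> card (V i) = n i"
    "arcs_ends G = {(u, v). \<exists>i\<in>?I. \<exists>j\<in>?I. i \<noteq> j \<and> u \<in> V i \<and> v \<in> V j}"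
    using assms(4) unfolding complete_multipartite_def by blast
  have pos: "card (V i) > 0" if "i \<in> ?I" for i using V(3) assms(2) that by fastforce
  interpret multipartite_parts G ?I V
  proof
    show "\<exists>i\<in>?I. \<exists>j\<in>?I. i \<noteq> j"
      using assms(1) by (intro bexI[of _ 1] bexI[of _ 2]) auto
    show "finite (V i)" "V i \<noteq> {}" if "i \<in> ?I" for i
      using pos[OF that] by (auto simp: card_gt_0_iff)
  qed (use V in auto)
  have "(\<forall>i\<in>?I. card (V i) \<le> 2 * k) \<longleftrightarrow> n 1 \<le> 2 * k" for k
    using V(3) assms(1,3) by (auto intro: order_trans[of _ "n 1"])
  moreover have "(\<Sum>i\<in>?I. card (V i)) = N" unfolding assms(5) using V(3) by (intro sum.cong) auto
  moreover have "2 * (\<Sum>i\<in>?I. (card (V i) + 1) div 2) = N + \<alpha>"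
  proof -
    have "(\<Sum>i\<in>?I. (card (V i) + 1) div 2) = (\<Sum>i\<in>?I. (n i + 1) div 2)"
      using V(3) by (intro sum.cong) auto
    then show ?thesis using sum_halves[of ?I n] assms(5,6) by simp
  qed
  ultimately have le_iff: "?q \<le> k \<longleftrightarrow> n 1 \<le> 2 * k \<and> N \<le> 3 * k \<and> N + \<alpha> \<le> 4 * k" for k
    using isometric_path_number_le_iff[of k] by auto
  have q: "n 1 \<le> 2 * ?q" "N \<le> 3 * ?q" "N + \<alpha> \<le> 4 * ?q" using le_iff[of ?q] by auto
  \<comment> \<open>\<beta> counts the odd parts other than the first. Each is nonempty, so \<beta>
    \<le> N - \<open>n 1\<close>, which links \<alpha> to the largest part.\<close>
  define \<beta> where "\<beta> = card {i\<in>{2..r}. odd (n i)}"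
  have I: "?I = insert 1 {2..r}" using assms(1) by auto
  have N: "N = n 1 + sum n {2..r}" unfolding assms(5) I by simp
  have "{i\<in>?I. odd (n i)} = (if odd (n 1) then {1} else {}) \<union> {i\<in>{2..r}. odd (n i)}"
    unfolding I by auto
  then have \<alpha>: "\<alpha> = (if odd (n 1) then 1 else 0) + \<beta>"
    unfolding assms(6) \<beta>_def by simp
  have "\<beta> \<le> card {2..r}" unfolding \<beta>_def by (intro card_mono) auto
  also have "\<dots> = (\<Sum>i\<in>{2..r}. 1)" by simp
  also have "\<dots> \<le> sum n {2..r}" using assms(2) by (intro sum_mono) auto
  finally have \<beta>: "n 1 + \<beta> \<le> N" using N by simp
  have "int ?q = \<lceil>real (n 1) / real 2\<rceil>" if c: "3 * n 1 > 2 * N"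
  proof (rule int_eq_ceiling_divide)
    fix k assume k: "n 1 \<le> 2 * k"
    \<comment> \<open>N + \<alpha> \<le> 2N - \<open>n 1\<close> + 1 \<le> 2 \<open>n 1\<close>
      \<le> 4k, the middle step by 2N < 3 \<open>n 1\<close>.\<close>
    have "N + \<alpha> \<le> 4 * k"
      using k c \<alpha> \<beta> by (cases "odd (n 1)") (auto elim!: oddE evenE)
    then show "?q \<le> k" using le_iff[of k] k c by simp
  qed (use q in auto)
  moreover have "int ?q = \<lceil>real (N + \<alpha>) / real 4\<rceil>" if c: "3 * \<alpha> > N"
  proof (rule int_eq_ceiling_divide)
    fix k assume k: "N + \<alpha> \<le> 4 * k"
    \<comment> \<open>Now \<open>n 1\<close> \<le> N - \<alpha> + 1 and 2(N - \<alpha>) = (N +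
      \<alpha>) + (N - 3\<alpha>) \<le> 4k - 1, so 2 \<open>n 1\<close> \<le> 4k + 1, and
      integrality removes the excess.\<close>
    have "\<alpha> \<le> \<beta> + 1" using \<alpha> by simp
    then have "n 1 \<le> 2 * k" using k c \<beta> by linarith
    then show "?q \<le> k" using le_iff[of k] k c by simp
  qed (use q in auto)
  moreover have "int ?q = \<lceil>real N / real 3\<rceil>" if c: "3 * \<alpha> \<le> N \<and> 3 * n 1 \<le> 2 * N"
  proof (rule int_eq_ceiling_divide)
    fix k assume k: "N \<le> 3 * k"
    show "?q \<le> k" using le_iff[of k] k c by simp
  qed (use q in auto)
  ultimately show ?thesis by simp
qed

end
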